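(* Let $F_n$, $n\ge1$, be distribution functions of probability measures on $\mathbb R_+$, let $\overline F_n:=1-F_n$, and let $X_{n,1}\ge\cdots\ge X_{n,n}$ be the nonincreasing order statistics of an i.i.d. sample of size $n$ from $F_n$. Suppose that there are points $x_n\in\mathbb R_+$ and constants $c_-,c_+>0$ with $$c_-n^{-1}\le\overline F_n(x_n)\le c_+n^{-1}\quad\text{for all }n,$$ and that there are constants $c,C>0$ and $\theta\in(0,1)$ such that, for all $n$, $$\frac{\overline F_n(x+y)}{\overline F_n(x)}\le Ce^{-cy}\qquad\text{for }\theta x_n\le x\le x_n\text{ and }y\ge0.$$ Then for every fixed integer $i\ge1$ there is a constant $C_2>0$ such that, with $c_2=c_-/(2C)$, for all $n\ge i$ and all $y\ge0$, $$\mathbb P[X_{n,i}-x_n>y]\le (c_+C)e^{-cy},$$ $$\mathbb P[X_{n,i}-x_n\le -y]\le C_2\,e^{-c_2e^{c(1-\theta)y}}.$$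
   Context: All constants are independent of $n$ and $y$; $C_2$ may depend on $i$. *)

theory Defs
  imports "HOL-Probability.Probability"
begin

definition nonneg_distribution_function :: "(real \<Rightarrow> real) \<Rightarrow> bool" where
  "nonneg_distribution_function F \<longleftrightarrow>
     (\<exists>\<mu>. real_distribution \<mu> \<and> measure \<mu> {0..} = 1 \<and> F = cdf \<mu>)"

(* The sample variables are indexed by 0, ..., n - 1; only these n components of X matter. *)
definition iid_sample ::
    "'a measure \<Rightarrow> nat \<Rightarrow> (nat \<Rightarrow> 'a \<Rightarrow> real) \<Rightarrow> (real \<Rightarrow> real) \<Rightarrow> bool" where
  "iid_sample M n X F \<longleftrightarrow>
     prob_space M \<and>
     prob_space.indep_vars M (\<lambda>_. borel) X {..<n} \<and>
     (\<forall>j<n. cdf (distr M borel (X j)) = F)"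

(* The i-th largest of x 0, ..., x (n - 1), counted with multiplicity and from i = 1, so that
   i = 1 gives the maximum; meaningful for 1 \<le> i \<le> n. *)
definition order_statistic :: "nat \<Rightarrow> nat \<Rightarrow> (nat \<Rightarrow> real) \<Rightarrow> real" where
  "order_statistic n i x = rev (sort (map x [0..<n])) ! (i - 1)"

end

theory Submission
  imports Defs
begin

text \<open>
  Both bounds compare the order statistic with the number
  \<open>N\<^sub>t\<close> of sample points above a level \<open>t\<close>: the \<open>i\<close>-th largest value exceeds \<open>t\<close> exactly
  when \<open>N\<^sub>t \<ge> i\<close>, and \<open>N\<^sub>t\<close> is a sum of independent Bernoulli variables with parameter
  \<open>1 - F t\<close>.

  For the upper tail the crude estimate \<open>P (N\<^sub>t \<ge> i) \<le> P (N\<^sub>t \<ge> 1) \<le> n (1 - F t)\<close> at the level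
  \<open>t = x n + y\<close> suffices, because the ratio condition started at \<open>x n\<close> turns it into
  \<open>c_plus C exp (- c y)\<close>.

  For the lower tail, read backwards, the ratio condition is a lower bound on
  the mean: at \<open>t = x n - y \<ge> 0\<close> one has
  \<open>n (1 - F t) \<ge> (c_minus / C) exp (c (1 - \<theta>) y)\<close>. The exponential Markov inequality for
  \<open>(1/2) ^ N\<^sub>t\<close> gives \<open>P (N\<^sub>t \<le> k) \<le> 2 ^ k exp (- E N\<^sub>t / 2)\<close>, so the mean enters with the factor
  \<open>1/2\<close> that appears in \<open>c\<^sub>2 = c_minus / (2 C)\<close>, and \<open>C\<^sub>2 = 2 ^ (i - 1)\<close> works. Levels
  \<open>t < 0\<close> are harmless since the sample is almost surely nonnegative.
\<close>

section \<open>Order statistics and exceedance counts\<close>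

lemma order_statistic_in_range:
  assumes "1 \<le> i" "i \<le> n"
  obtains j where "j < n" "order_statistic n i x = x j"
proof -
  have "order_statistic n i x \<in> set (rev (sort (map x [0..<n])))"
    unfolding order_statistic_def using assms by (intro nth_mem) simp
  then have "order_statistic n i x \<in> x ` {..<n}"
    by (simp add: atLeast0LessThan)
  then show thesis using that by blast
qed

text \<open>
  In the decreasing rearrangement, every entry from position \<open>i\<close> on is at most the \<open>i\<close>-th one, so
  the entries above \<open>t\<close> all lie among the first \<open>i - 1\<close>.
\<close>

lemma card_above_le_of_order_statistic_le:
  fixes x :: "nat \<Rightarrow> real"
  assumes "1 \<le> i" "i \<le> n" "order_statistic n i x \<le> t"
  shows "card {j \<in> {..<n}. t < x j} \<le> i - 1"
proof -
  define L where "L = rev (sort (map x [0..<n]))"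
  have len: "length L = n" by (simp add: L_def)
  have desc: "L ! k \<le> L ! (i - 1)" if "i - 1 \<le> k" "k < n" for k
    using that unfolding L_def
    by (simp add: rev_nth sorted_nth_mono)
  have "\<forall>v \<in> set (drop (i - 1) L). v \<le> t"
  proof
    fix v assume "v \<in> set (drop (i - 1) L)"
    then obtain k where "k < n - (i - 1)" "v = L ! (i - 1 + k)"
      using len assms(1,2) by (auto simp: in_set_conv_nth)
    then have "v \<le> L ! (i - 1)" using desc[of "i - 1 + k"] by simp
    then show "v \<le> t" using assms(3) by (simp add: order_statistic_def L_def)
  qed
  then have "filter ((<) t) (drop (i - 1) L) = []"
    by (force simp: filter_empty_conv)
  then have "length (filter ((<) t) L) = length (filter ((<) t) (take (i - 1) L))"
    by (metis append_Nil2 append_take_drop_id filter_append)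
  also have "\<dots> \<le> i - 1"
    by (rule order_trans[OF length_filter_le]) simp
  finally have "length (filter ((<) t) L) \<le> i - 1" .
  moreover have "mset L = mset (map x [0..<n])" by (simp add: L_def)
  then have "length (filter ((<) t) L) = length (filter ((<) t) (map x [0..<n]))"
    by (metis mset_filter size_mset)
  moreover have "\<dots> = length (filter (\<lambda>j. t < x j) [0..<n])"
    by (simp add: filter_map o_def)
  moreover have "\<dots> = card {j \<in> {..<n}. t < x j}"
    by (subst distinct_card[symmetric]) (auto intro: arg_cong[where f = card])
  ultimately show ?thesis by simp
qed

section \<open>Few successes among independent events\<close>

text \<open>
  A Chernoff bound for a sum \<open>N\<close> of independent, not necessarily identically distributed,
  indicators: Markov's inequality is applied to \<open>s ^ N\<close>, which is at least \<open>s ^ k\<close> on \<open>N \<le> k\<close>, and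
  whose expectation factorises into terms \<open>1 - (1 - s) p \<le> exp (- (1 - s) p)\<close>.
\<close>

lemma (in prob_space) prob_few_hits_le:
  fixes s :: real
  assumes fin: "finite I"
    and indep: "indep_vars N X I"
    and B: "\<And>j. j \<in> I \<Longrightarrow> B j \<in> sets (N j)"
    and s: "0 < s" "s \<le> 1"
  shows "prob {\<omega> \<in> space M. card {j \<in> I. X j \<omega> \<in> B j} \<le> k}
    \<le> exp (- (1 - s) * (\<Sum>j\<in>I. prob {\<omega> \<in> space M. X j \<omega> \<in> B j})) / s ^ k"
proof -
  have rv: "X j \<in> measurable M (N j)" if "j \<in> I" for j
    using indep that by (auto simp: indep_vars_def)
  have hit: "{\<omega> \<in> space M. X j \<omega> \<in> B j} \<in> events" if "j \<in> I" for j
    using measurable_sets[OF rv[OF that] B[OF that]]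
    by (simp add: vimage_def Int_def conj_commute)
  define f where "f j v = (if v \<in> B j then s else 1)" for j v
  define Y where "Y = (\<lambda>j \<omega>. f j (X j \<omega>))"
  have f: "f j \<in> borel_measurable (N j)" if "j \<in> I" for j
    unfolding f_def using B[OF that] by measurable
  have Ym: "Y j \<in> borel_measurable M" if "j \<in> I" for j
    unfolding Y_def using rv[OF that] f[OF that] by measurable
  have Yint: "integrable M (Y j)" if "j \<in> I" for j
    using Ym[OF that] s by (intro integrable_const_bound[where B = 1]) (auto simp: Y_def f_def)
  have indepY: "indep_vars (\<lambda>_. borel) Y I"
    unfolding Y_def using indep f by (rule indep_vars_compose2)
  have EY: "expectation (Y j) \<le> exp (- (1 - s) * prob {\<omega> \<in> space M. X j \<omega> \<in> B j})"
    if "j \<in> I" for j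
  proof -
    let ?H = "{\<omega> \<in> space M. X j \<omega> \<in> B j}"
    have "expectation (Y j) = expectation (\<lambda>\<omega>. 1 - (1 - s) * indicator ?H \<omega>)"
      by (intro Bochner_Integration.integral_cong) (auto simp: Y_def f_def indicator_def)
    also have "\<dots> = 1 - (1 - s) * prob ?H"
      using hit[OF that] by (simp add: prob_space emeasure_eq_measure)
    also have "\<dots> \<le> exp (- (1 - s) * prob ?H)"
      using exp_ge_add_one_self[of "- (1 - s) * prob ?H"] by linarith
    finally show ?thesis .
  qed
  have prodY: "(\<Prod>j\<in>I. Y j \<omega>) = s ^ card {j \<in> I. X j \<omega> \<in> B j}" for \<omega>
    using fin by (simp add: Y_def f_def prod.If_cases Int_def)
  have "{\<omega> \<in> space M. card {j \<in> I. X j \<omega> \<in> B j} \<le> k} \<subseteq> {\<omega> \<in> space M. s ^ k \<le> (\<Prod>j\<in>I. Y j \<omega>)}"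
    using s by (auto simp: prodY intro: power_decreasing)
  then have "prob {\<omega> \<in> space M. card {j \<in> I. X j \<omega> \<in> B j} \<le> k}
      \<le> prob {\<omega> \<in> space M. s ^ k \<le> (\<Prod>j\<in>I. Y j \<omega>)}"
    using Ym by (intro finite_measure_mono) measurable
  also have "\<dots> \<le> expectation (\<lambda>\<omega>. \<Prod>j\<in>I. Y j \<omega>) / s ^ k"
    using s by (intro integral_Markov_inequality_measure[where A = "{}"]
        indep_vars_integrable[OF fin indepY Yint])
      (auto simp: prodY)
  also have "expectation (\<lambda>\<omega>. \<Prod>j\<in>I. Y j \<omega>) = (\<Prod>j\<in>I. expectation (Y j))"
    by (rule indep_vars_lebesgue_integral[OF fin indepY Yint])
  also have "\<dots> \<le> (\<Prod>j\<in>I. exp (- (1 - s) * prob {\<omega> \<in> space M. X j \<omega> \<in> B j}))"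
    using EY s by (intro prod_mono conjI Bochner_Integration.integral_nonneg) (auto simp: Y_def f_def)
  also have "\<dots> = exp (- (1 - s) * (\<Sum>j\<in>I. prob {\<omega> \<in> space M. X j \<omega> \<in> B j}))"
    using fin by (simp add: exp_sum sum_distrib_left)
  finally show ?thesis using s by (simp add: divide_right_mono)
qed

section \<open>Order statistics of an i.i.d. sample\<close>

lemma nonneg_distribution_function_neg:
  assumes "nonneg_distribution_function F" "t < 0"
  shows "F t = 0"
proof -
  obtain \<mu> where \<mu>: "real_distribution \<mu>" "measure \<mu> {0..} = 1" "F = cdf \<mu>"
    using assms(1) by (auto simp: nonneg_distribution_function_def)
  interpret real_distribution \<mu> by fact
  have "measure \<mu> {..t} + measure \<mu> {0..} = measure \<mu> ({..t} \<union> {0..})"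
    using assms(2) by (intro finite_measure_Union[symmetric]) auto
  also have "\<dots> \<le> 1" by simp
  finally show ?thesis using \<mu> by (simp add: cdf_def measure_le_0_iff)
qed

lemma nonneg_distribution_function_mono:
  assumes "nonneg_distribution_function F" "s \<le> t"
  shows "F s \<le> F t"
proof -
  obtain \<mu> where \<mu>: "real_distribution \<mu>" "F = cdf \<mu>"
    using assms(1) by (auto simp: nonneg_distribution_function_def)
  interpret real_distribution \<mu> by fact
  show ?thesis using \<mu> cdf_nondecreasing[OF assms(2)] by simp
qed

lemma iid_sample_marginals:
  assumes "iid_sample M n X F" "j < n"
  shows iid_sample_measurable: "X j \<in> borel_measurable M"
    and iid_sample_prob_le: "measure M {\<omega> \<in> space M. X j \<omega> \<le> t} = F t"
    and iid_sample_prob_gt: "measure M {\<omega> \<in> space M. t < X j \<omega>} = 1 - F t"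
proof -
  interpret prob_space M using assms by (simp add: iid_sample_def)
  show rv: "X j \<in> borel_measurable M"
    using assms by (auto simp: iid_sample_def indep_vars_def)
  have "F t = cdf (distr M borel (X j)) t" using assms by (simp add: iid_sample_def)
  also have "\<dots> = prob {\<omega> \<in> space M. X j \<omega> \<le> t}"
    using rv by (simp add: cdf_def measure_distr vimage_def Int_def conj_commute)
  finally show le: "prob {\<omega> \<in> space M. X j \<omega> \<le> t} = F t" by simp
  have "{\<omega> \<in> space M. t < X j \<omega>} = space M - {\<omega> \<in> space M. X j \<omega> \<le> t}" by auto
  then show "prob {\<omega> \<in> space M. t < X j \<omega>} = 1 - F t"
    using rv le prob_compl[of "{\<omega> \<in> space M. X j \<omega> \<le> t}"] by simp
qed

text \<open>
  Any order statistic is one of the sample values, so the union bound over the sample controls the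
  probability that it lies in a given set.
\<close>

lemma prob_order_statistic_le_sum:
  assumes "prob_space M" "1 \<le> i" "i \<le> n"
    and rv: "\<And>j. j < n \<Longrightarrow> {\<omega> \<in> space M. P (X j \<omega>)} \<in> sets M"
  shows "measure M {\<omega> \<in> space M. P (order_statistic n i (\<lambda>j. X j \<omega>))}
    \<le> (\<Sum>j<n. measure M {\<omega> \<in> space M. P (X j \<omega>)})"
proof -
  interpret prob_space M by fact
  have "{\<omega> \<in> space M. P (order_statistic n i (\<lambda>j. X j \<omega>))}
      \<subseteq> (\<Union>j\<in>{..<n}. {\<omega> \<in> space M. P (X j \<omega>)})"
  proof
    fix \<omega> assume "\<omega> \<in> {\<omega> \<in> space M. P (order_statistic n i (\<lambda>j. X j \<omega>))}"
    moreover obtain j where "j < n" "order_statistic n i (\<lambda>j. X j \<omega>) = X j \<omega>"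
      using order_statistic_in_range[OF assms(2,3), of "\<lambda>j. X j \<omega>"] .
    ultimately show "\<omega> \<in> (\<Union>j\<in>{..<n}. {\<omega> \<in> space M. P (X j \<omega>)})" by auto
  qed
  then have "prob {\<omega> \<in> space M. P (order_statistic n i (\<lambda>j. X j \<omega>))}
      \<le> prob (\<Union>j\<in>{..<n}. {\<omega> \<in> space M. P (X j \<omega>)})"
    using rv by (intro finite_measure_mono) auto
  also have "\<dots> \<le> (\<Sum>j<n. prob {\<omega> \<in> space M. P (X j \<omega>)})"
    using rv by (intro finite_measure_subadditive_finite) auto
  finally show ?thesis .
qed

lemma prob_order_statistic_gt_le:
  assumes "iid_sample M n X F" "1 \<le> i" "i \<le> n"
  shows "measure M {\<omega> \<in> space M. t < order_statistic n i (\<lambda>j. X j \<omega>)} \<le> real n * (1 - F t)"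
proof -
  have "measure M {\<omega> \<in> space M. t < order_statistic n i (\<lambda>j. X j \<omega>)}
      \<le> (\<Sum>j<n. measure M {\<omega> \<in> space M. t < X j \<omega>})"
    using assms iid_sample_measurable[OF assms(1)]
    by (intro prob_order_statistic_le_sum) (auto simp: iid_sample_def)
  then show ?thesis using iid_sample_prob_gt[OF assms(1)] by simp
qed

text \<open>
  Far too weak in general, but exact at levels where \<open>F t = 0\<close>, where the exponential bound below
  only gives \<open>exp (- n / 2)\<close> up to a constant.
\<close>

lemma prob_order_statistic_le_union:
  assumes "iid_sample M n X F" "1 \<le> i" "i \<le> n"
  shows "measure M {\<omega> \<in> space M. order_statistic n i (\<lambda>j. X j \<omega>) \<le> t} \<le> real n * F t"
proof -
  have "measure M {\<omega> \<in> space M. order_statistic n i (\<lambda>j. X j \<omega>) \<le> t}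
      \<le> (\<Sum>j<n. measure M {\<omega> \<in> space M. X j \<omega> \<le> t})"
    using assms iid_sample_measurable[OF assms(1)]
    by (intro prob_order_statistic_le_sum) (auto simp: iid_sample_def)
  then show ?thesis using iid_sample_prob_le[OF assms(1)] by simp
qed

text \<open>
  The parameter \<open>s = 1/2\<close> in the Chernoff bound is what yields the constant \<open>c\<^sub>2 = c_minus / (2 C)\<close>;
  any smaller \<open>s\<close> would improve the exponent at the price of the prefactor \<open>(1 / s) ^ (i - 1)\<close>.
\<close>

lemma prob_order_statistic_le_chernoff:
  assumes "iid_sample M n X F" "1 \<le> i" "i \<le> n"
  shows "measure M {\<omega> \<in> space M. order_statistic n i (\<lambda>j. X j \<omega>) \<le> t}
    \<le> 2 ^ (i - 1) * exp (- (real n * (1 - F t)) / 2)"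
proof -
  interpret prob_space M using assms by (simp add: iid_sample_def)
  have indep: "indep_vars (\<lambda>_. borel) X {..<n}" using assms by (simp add: iid_sample_def)
  note [measurable] = iid_sample_measurable[OF assms(1)]
  have "prob {\<omega> \<in> space M. order_statistic n i (\<lambda>j. X j \<omega>) \<le> t}
      \<le> prob {\<omega> \<in> space M. card {j \<in> {..<n}. X j \<omega> \<in> {t<..}} \<le> i - 1}"
    using card_above_le_of_order_statistic_le[OF assms(2,3)]
    by (intro finite_measure_mono) (auto, measurable)
  also have "\<dots> \<le> exp (- (1 - 1/2) * (\<Sum>j<n. prob {\<omega> \<in> space M. X j \<omega> \<in> {t<..}})) / (1/2) ^ (i - 1)"
    by (intro prob_few_hits_le[where N = "\<lambda>_. borel"] indep) auto
  also have "(\<Sum>j<n. prob {\<omega> \<in> space M. X j \<omega> \<in> {t<..}}) = real n * (1 - F t)"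
    using iid_sample_prob_gt[OF assms(1)] by simp
  finally show ?thesis by (simp add: power_one_over mult.commute)
qed

section \<open>Growth of the tail below the reference level\<close>

text \<open>
  Within the window \<open>[\<theta> a, a]\<close> the ratio condition gives growth of the tail \<open>G\<close> at the full rate
  \<open>c\<close> as the level decreases. Below the window, monotonicity only preserves the value at \<open>\<theta> a\<close>,
  where the gain is \<open>exp (c (1 - \<theta>) a)\<close>; since \<open>y \<le> a\<close>, this is where the reduced
  rate \<open>c (1 - \<theta>)\<close> comes from.
\<close>

lemma tail_growth_below:
  fixes G :: "real \<Rightarrow> real"
  assumes "antimono G" "0 < G a" "0 < c" "0 < C" "0 \<le> \<theta>" "\<theta> \<le> 1"
    and ratio: "\<And>u y. \<theta> * a \<le> u \<Longrightarrow> u \<le> a \<Longrightarrow> 0 \<le> y \<Longrightarrow> G (u + y) / G u \<le> C * exp (- c * y)"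
    and y: "0 \<le> y" "y \<le> a"
  shows "G a / C * exp (c * (1 - \<theta>) * y) \<le> G (a - y)"
proof -
  have window: "G a / C * exp (c * z) \<le> G (a - z)" if "0 \<le> z" "z \<le> (1 - \<theta>) * a" for z
  proof -
    have "0 < G (a - z)"
      using assms(2) antimonoD[OF assms(1), of "a - z" a] that by simp
    moreover have "G (a - z + z) / G (a - z) \<le> C * exp (- c * z)"
      using that by (intro ratio) (auto simp: algebra_simps)
    ultimately have "G a \<le> C * exp (- c * z) * G (a - z)"
      by (simp add: divide_le_eq)
    then have "G a * exp (c * z) \<le> C * G (a - z) * (exp (- c * z) * exp (c * z))"
      by (simp add: mult.assoc mult.left_commute)
        (metis exp_gt_zero less_imp_le mult.assoc mult.commute mult_right_mono)
    then show ?thesis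
      using assms(4) by (simp add: exp_add[symmetric] field_simps)
  qed
  define z where "z = min y ((1 - \<theta>) * a)"
  have z: "0 \<le> z" "z \<le> (1 - \<theta>) * a" "z \<le> y"
    using y assms(5,6) by (auto simp: z_def)
  have "(1 - \<theta>) * y \<le> z"
    using y assms(5,6) by (auto simp: z_def mult_left_mono mult_left_le_one_le)
  then have "c * (1 - \<theta>) * y \<le> c * z" using assms(3) by (simp add: mult.assoc)
  then have "G a / C * exp (c * (1 - \<theta>) * y) \<le> G a / C * exp (c * z)"
    using assms(2,4) by (intro mult_left_mono) auto
  also have "\<dots> \<le> G (a - z)" using z by (intro window) auto
  also have "\<dots> \<le> G (a - y)" using z by (intro antimonoD[OF assms(1)]) auto
  finally show ?thesis .
qed

section \<open>Exponential and double exponential deviation bounds\<close>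

theorem lemma9p1:
  fixes F :: "nat \<Rightarrow> real \<Rightarrow> real"
    and M :: "nat \<Rightarrow> 'a measure"
    and X :: "nat \<Rightarrow> nat \<Rightarrow> 'a \<Rightarrow> real"
    and x :: "nat \<Rightarrow> real"
    and c_minus c_plus c C \<theta> :: real
    and i :: nat
  assumes F: "\<And>n. 1 \<le> n \<Longrightarrow> nonneg_distribution_function (F n)"
    and X: "\<And>n. 1 \<le> n \<Longrightarrow> iid_sample (M n) n (X n) (F n)"
    and x_nonneg: "\<And>n. 1 \<le> n \<Longrightarrow> 0 \<le> x n"
    and c_pm_pos: "0 < c_minus" "0 < c_plus"
    and tail_at_x: "\<And>n. 1 \<le> n \<Longrightarrow>
      c_minus / real n \<le> 1 - F n (x n) \<and> 1 - F n (x n) \<le> c_plus / real n"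
    and params: "0 < c" "0 < C" "0 < \<theta>" "\<theta> < 1"
    and tail_ratio: "\<And>n u y. 1 \<le> n \<Longrightarrow> \<theta> * x n \<le> u \<Longrightarrow> u \<le> x n \<Longrightarrow> 0 \<le> y \<Longrightarrow>
      (1 - F n (u + y)) / (1 - F n u) \<le> C * exp (- c * y)"
    and i: "1 \<le> i"
  shows "\<exists>C\<^sub>2>0. \<forall>n\<ge>i. \<forall>y\<ge>0.
    measure (M n) {\<omega> \<in> space (M n). order_statistic n i (\<lambda>j. X n j \<omega>) - x n > y}
      \<le> (c_plus * C) * exp (- c * y) \<and>
    measure (M n) {\<omega> \<in> space (M n). order_statistic n i (\<lambda>j. X n j \<omega>) - x n \<le> - y}
      \<le> C\<^sub>2 * exp (- (c_minus / (2 * C)) * exp (c * (1 - \<theta>) * y))"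
proof (intro exI[of _ "2 ^ (i - 1)"] conjI allI impI)
  fix n y assume n: "i \<le> n" and y: "0 \<le> (y::real)"
  have n1: "1 \<le> n" and npos: "0 < real n" using i n by auto
  let ?S = "\<lambda>\<omega>. order_statistic n i (\<lambda>j. X n j \<omega>)"
  define G where "G t = 1 - F n t" for t
  have G: "c_minus / real n \<le> G (x n)" "G (x n) \<le> c_plus / real n"
    using tail_at_x[OF n1] by (auto simp: G_def)
  have Gpos: "0 < G (x n)"
    using G(1) c_pm_pos npos by (smt (verit) divide_pos_pos)
  have ratio: "G (u + z) / G u \<le> C * exp (- c * z)" if "\<theta> * x n \<le> u" "u \<le> x n" "0 \<le> z" for u z
    using tail_ratio[OF n1 that] by (simp add: G_def)
  show "measure (M n) {\<omega> \<in> space (M n). ?S \<omega> - x n > y} \<le> (c_plus * C) * exp (- c * y)"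
  proof -
    have "{\<omega> \<in> space (M n). ?S \<omega> - x n > y} = {\<omega> \<in> space (M n). x n + y < ?S \<omega>}" by auto
    then have "measure (M n) {\<omega> \<in> space (M n). ?S \<omega> - x n > y} \<le> real n * G (x n + y)"
      using prob_order_statistic_gt_le[OF X[OF n1] i n, of "x n + y"] by (simp add: G_def)
    also have "G (x n + y) \<le> C * exp (- c * y) * G (x n)"
      using ratio[of "x n" y] Gpos y params x_nonneg[OF n1]
      by (simp add: divide_le_eq mult_left_le_one_le)
    also have "\<dots> \<le> C * exp (- c * y) * (c_plus / real n)"
      using G(2) params by (intro mult_left_mono) auto
    finally show ?thesis using npos by (simp add: field_simps)
  qed
  show "measure (M n) {\<omega> \<in> space (M n). ?S \<omega> - x n \<le> - y}
      \<le> 2 ^ (i - 1) * exp (- (c_minus / (2 * C)) * exp (c * (1 - \<theta>) * y))"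
  proof -
    have ev: "{\<omega> \<in> space (M n). ?S \<omega> - x n \<le> - y} = {\<omega> \<in> space (M n). ?S \<omega> \<le> x n - y}" by auto
    show ?thesis
    proof (cases "y \<le> x n")
      case True
      \<comment> \<open>The level is still nonnegative, so the mean number of exceedances is large.\<close>
      have "antimono G"
        using nonneg_distribution_function_mono[OF F[OF n1]] by (auto simp: antimono_def G_def)
      then have "G (x n) / C * exp (c * (1 - \<theta>) * y) \<le> G (x n - y)"
        using Gpos params ratio y True by (intro tail_growth_below) auto
      moreover have "c_minus / real n / C * exp (c * (1 - \<theta>) * y)
          \<le> G (x n) / C * exp (c * (1 - \<theta>) * y)"
        using G(1) params by (intro mult_right_mono divide_right_mono) auto
      ultimately have "c_minus / real n / C * exp (c * (1 - \<theta>) * y) \<le> G (x n - y)"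
        by linarith
      then have "c_minus / C * exp (c * (1 - \<theta>) * y) \<le> real n * G (x n - y)"
        using npos params by (simp add: field_simps)
      then have "exp (- (real n * G (x n - y)) / 2)
          \<le> exp (- (c_minus / (2 * C)) * exp (c * (1 - \<theta>) * y))"
        by (simp add: field_simps)
      moreover have "measure (M n) {\<omega> \<in> space (M n). ?S \<omega> \<le> x n - y}
          \<le> 2 ^ (i - 1) * exp (- (real n * G (x n - y)) / 2)"
        using prob_order_statistic_le_chernoff[OF X[OF n1] i n, of "x n - y"] by (simp add: G_def)
      ultimately show ?thesis
        unfolding ev by (smt (verit) mult_left_mono zero_le_power)
    next
      case False
      \<comment> \<open>The level is negative, where the sample has no mass.\<close>
      then have "F n (x n - y) = 0"
        by (intro nonneg_distribution_function_neg[OF F[OF n1]]) simp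
      then have "measure (M n) {\<omega> \<in> space (M n). ?S \<omega> - x n \<le> - y} \<le> 0"
        unfolding ev using prob_order_statistic_le_union[OF X[OF n1] i n, of "x n - y"] by simp
      also have "0 \<le> 2 ^ (i - 1) * exp (- (c_minus / (2 * C)) * exp (c * (1 - \<theta>) * y))" by simp
      finally show ?thesis .
    qed
  qed
qed simp

end
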